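(* Let $M$ be a totally real number field of degree $m$ and let $K=M(\xi)$ be an extension of $M$ of degree $k$, where $\xi$ is an algebraic integer with relative defining polynomial $f(x)\in\mathbb{Z}_M[x]$ over $M$, such that for every $i=1,\dots,m$ all roots $\xi^{(i1)},\dots,\xi^{(ik)}$ of the conjugate polynomial $f^{(i)}(x)$ are non-real. Set \[ c_0=\frac{1}{\min_{i,j}|\mathrm{Im}(\xi^{(ij)})|}. \] Let $0\neq\nu\in\mathbb{Z}_M$, let $F(X,Y)=N_{K/M}(X-\xi Y)$, and consider the relative Thue equation $F(X,Y)=\nu$ in $X,Y\in\mathbb{Z}_M$. Then every solution $X,Y\in\mathbb{Z}_M$ satisfies \[ \max\bigl(\overline{|X|},\overline{|Y|}\bigr)\le \overline{|\nu|}^{\,1/k}\bigl(1+c_0\,\overline{|\xi|}\bigr). \]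
   Context: $\mathbb{Z}_M$ denotes the ring of algebraic integers of $M$. $f^{(i)}$ is the polynomial obtained by applying the $i$-th embedding of $M$ into $\mathbb{R}$ to the coefficients of $f$ ($i=1,\dots,m$), and $\xi^{(i1)},\dots,\xi^{(ik)}$ are its roots. For an algebraic number $Z$, $\overline{|Z|}$ (the size, or house, of $Z$) denotes the maximum of the absolute values of its conjugates; for $\xi$ this is $\max_{i,j}|\xi^{(ij)}|$, and for $Z\in M$ it is $\max_i |Z^{(i)}|$ over the $m$ conjugates of $Z$. *)

theory Defs
  imports Complex_Main "HOL-Library.FuncSet" "HOL-Algebra.Algebraic_Closure_Type"
    "HOL-Algebra.Generated_Fields"
begin

text \<open>
  Number fields are taken to be subfields of \<open>\<complex>\<close> of finite degree over \<open>\<rat>\<close>.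
\<close>

abbreviation complex_ring :: "complex ring" where
  "complex_ring \<equiv> ring_of_type_algebra"

definition integers_of :: "complex set \<Rightarrow> complex set" where
  "integers_of L = {x \<in> L. algebraic_int x}"

text \<open>
  Since \<open>ring_hom\<close> only constrains a function on the carrier, embeddings are
  normalised outside \<open>L\<close> by \<open>extensional\<close>; otherwise an embedding of \<open>L\<close> would be
  represented by many functions, and products over all embeddings would be meaningless.
\<close>

definition embeddings :: "complex set \<Rightarrow> (complex \<Rightarrow> complex) set" where
  "embeddings L = ring_hom (complex_ring\<lparr>carrier := L\<rparr>) complex_ring \<inter> extensional L"

definition totally_real :: "complex set \<Rightarrow> bool" where
  "totally_real L \<longleftrightarrow> (\<forall>\<sigma>\<in>embeddings L. \<sigma> ` L \<subseteq> \<real>)"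

definition rel_norm :: "complex set \<Rightarrow> complex set \<Rightarrow> complex \<Rightarrow> complex" where
  "rel_norm M K x = (\<Prod>\<tau>\<in>{\<tau> \<in> embeddings K. \<forall>a\<in>M. \<tau> a = a}. \<tau> x)"

definition is_min_poly :: "complex set \<Rightarrow> complex \<Rightarrow> complex poly \<Rightarrow> bool" where
  "is_min_poly L x p \<longleftrightarrow>
     (\<forall>i. coeff p i \<in> L) \<and> Polynomial.lead_coeff p = 1 \<and> poly p x = 0 \<and>
     (\<forall>q. (\<forall>i. coeff q i \<in> L) \<longrightarrow> q \<noteq> 0 \<longrightarrow> poly q x = 0 \<longrightarrow>
          Polynomial.degree p \<le> Polynomial.degree q)"

definition conjugates :: "complex \<Rightarrow> complex set" where
  "conjugates x = {z. \<exists>p. is_min_poly \<rat> x p \<and> poly p z = 0}"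

text \<open>Only meaningful for algebraic \<open>x\<close>: otherwise \<open>conjugates x\<close> is empty.\<close>

definition house :: "complex \<Rightarrow> real" where
  "house x = Max (cmod ` conjugates x)"

text \<open>Only meaningful if the coefficients of \<open>f\<close> lie in \<open>M\<close>, since embeddings are undefined elsewhere.\<close>

definition conjugate_roots :: "complex set \<Rightarrow> complex poly \<Rightarrow> complex set" where
  "conjugate_roots M f = (\<Union>\<sigma>\<in>embeddings M. {z. poly (map_poly \<sigma> f) z = 0})"

end

theory Submission
  imports Defs
begin

text \<open>
  The roots of \<open>f\<close> correspond to the embeddings of \<open>K\<close> over \<open>M\<close>, so \<open>F x y\<close> is the homogenisation of
  \<open>f\<close>. Applying an embedding \<open>\<sigma>\<close> of \<open>M\<close> to \<open>F x y = \<nu>\<close> therefore factors \<open>\<sigma> \<nu>\<close> into \<open>k\<close> linear forms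
  \<open>\<sigma> x - z * \<sigma> y\<close>, with \<open>z\<close> running over the roots of \<open>map_poly \<sigma> f\<close>, and one of them has modulus at
  most \<open>root k (house \<nu>)\<close>. Since \<open>\<sigma> x\<close> and \<open>\<sigma> y\<close> are real, its imaginary part is \<open>- Im z * \<sigma> y\<close>, which
  bounds \<open>\<sigma> y\<close>; the bound for \<open>\<sigma> x\<close> follows by the triangle inequality. The bound for \<open>y\<close> is
  \<open>c\<^sub>0 * root k (house \<nu>)\<close>, and it is at most the claimed one because \<open>house \<xi> \<ge> 1\<close>.
  Finally, every conjugate of \<open>x \<in> M\<close> is \<open>\<sigma> x\<close> for some \<open>\<sigma>\<close>, because embeddings extend to finite
  extensions.
\<close>

subsection \<open>Subfields of the complex numbers\<close>

lemma complex_field: "field complex_ring"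
  by (rule field_from_type_algebra)

interpretation complex_ring: ring complex_ring
  by (rule ring_from_type_algebra)

lemma complex_ring_simps [simp]:
  "carrier complex_ring = UNIV" "x \<otimes>\<^bsub>complex_ring\<^esub> y = x * y" "\<one>\<^bsub>complex_ring\<^esub> = 1"
  "\<zero>\<^bsub>complex_ring\<^esub> = 0" "x \<oplus>\<^bsub>complex_ring\<^esub> y = x + y"
  by (simp_all add: ring_of_type_algebra_def)

lemma complex_ring_a_inv [simp]: "\<ominus>\<^bsub>complex_ring\<^esub> x = - x"
  by (rule complex_ring.minus_equality) auto

lemma complex_ring_m_inv: "x \<noteq> 0 \<Longrightarrow> inv\<^bsub>complex_ring\<^esub> x = inverse x"
  by (rule complex_ring.inv_unique'[symmetric]) auto

lemma subfield_closed:
  assumes "subfield L complex_ring"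
  shows "0 \<in> L" "1 \<in> L" "a \<in> L \<Longrightarrow> b \<in> L \<Longrightarrow> a + b \<in> L" "a \<in> L \<Longrightarrow> b \<in> L \<Longrightarrow> a * b \<in> L"
    "a \<in> L \<Longrightarrow> - a \<in> L" "a \<in> L \<Longrightarrow> b \<in> L \<Longrightarrow> a - b \<in> L" "a \<in> L \<Longrightarrow> inverse a \<in> L"
    "a \<in> L \<Longrightarrow> b \<in> L \<Longrightarrow> a / b \<in> L"
proof -
  note r = subringE[OF subfieldE(1)[OF assms]]
  show z: "0 \<in> L" and "1 \<in> L" using r(2,3) by simp_all
  show add: "a \<in> L \<Longrightarrow> b \<in> L \<Longrightarrow> a + b \<in> L" for a b using r(7)[of a b] by simp
  show mult: "a \<in> L \<Longrightarrow> b \<in> L \<Longrightarrow> a * b \<in> L" for a b using r(6)[of a b] by simp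
  show um: "a \<in> L \<Longrightarrow> - a \<in> L" for a using r(5)[of a] by simp
  show "a \<in> L \<Longrightarrow> b \<in> L \<Longrightarrow> a - b \<in> L"
    using add[OF _ um] by (metis diff_conv_add_uminus)
  show inv: "a \<in> L \<Longrightarrow> inverse a \<in> L" for a
    using complex_ring.subfield_m_inv(1)[OF assms, of a] z
    by (cases "a = 0") (auto simp: complex_ring_m_inv)
  show "a \<in> L \<Longrightarrow> b \<in> L \<Longrightarrow> a / b \<in> L"
    using mult inv[of b] by (simp add: divide_inverse)
qed

lemma subfield_complexI:
  assumes "1 \<in> L" "\<And>a b. a \<in> L \<Longrightarrow> b \<in> L \<Longrightarrow> a + b \<in> L"
    "\<And>a b. a \<in> L \<Longrightarrow> b \<in> L \<Longrightarrow> a * b \<in> L"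
    "\<And>a. a \<in> L \<Longrightarrow> - a \<in> L" "\<And>a. a \<in> L \<Longrightarrow> a \<noteq> 0 \<Longrightarrow> inverse a \<in> L"
  shows "subfield L complex_ring"
  by (rule field.subfieldI'[OF complex_field])
    (use assms in \<open>auto intro!: complex_ring.subringI simp: complex_ring_m_inv\<close>)

lemma subfield_Rats: "subfield \<rat> complex_ring"
  by (rule subfield_complexI) auto

lemma subfield_power: "subfield L complex_ring \<Longrightarrow> a \<in> L \<Longrightarrow> a ^ n \<in> L"
  by (induction n) (auto intro: subfield_closed)

lemma subfield_sum: "subfield L complex_ring \<Longrightarrow> (\<And>i. i \<in> A \<Longrightarrow> g i \<in> L) \<Longrightarrow> sum g A \<in> L"
  by (induction A rule: infinite_finite_induct) (auto intro: subfield_closed)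

lemma subfield_of_nat: "subfield L complex_ring \<Longrightarrow> of_nat n \<in> L"
  by (induction n) (auto intro: subfield_closed)

lemma Rats_subset_subfield:
  assumes "subfield L complex_ring"
  shows "\<rat> \<subseteq> L"
proof
  fix x :: complex
  assume "x \<in> \<rat>"
  then obtain a b :: int where x: "x = of_int a / of_int b"
    by (auto elim: Rats_cases')
  have "of_int c \<in> L" for c
    by (cases c rule: int_diff_cases) (simp add: assms subfield_closed(6) subfield_of_nat)
  with x show "x \<in> L" by (auto intro: subfield_closed(8)[OF assms])
qed

subsection \<open>Polynomials over a subfield\<close>

text \<open>Polynomials over \<open>L\<close> remain in the type \<open>complex poly\<close>, so
  degree, evaluation and divisibility are those of the type, and membership of the coefficients in
  \<open>L\<close> is tracked separately.\<close>

definition polys_over :: "complex set \<Rightarrow> complex poly set" where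
  "polys_over L = {p. \<forall>i. coeff p i \<in> L}"

text \<open>This is the ring \<open>L[\<alpha>]\<close>. It is a field once \<alpha> is algebraic
  over \<open>L\<close>, and each element then comes with a polynomial on which an embedding can be
  computed.\<close>

definition adjoin :: "complex set \<Rightarrow> complex \<Rightarrow> complex set" where
  "adjoin L \<alpha> = (\<lambda>p. poly p \<alpha>) ` polys_over L"

lemma polys_over_coeff: "p \<in> polys_over L \<Longrightarrow> coeff p i \<in> L"
  by (simp add: polys_over_def)

lemma polys_over_mono: "L \<subseteq> L' \<Longrightarrow> polys_over L \<subseteq> polys_over L'"
  by (auto simp: polys_over_def)

context
  fixes L :: "complex set"
  assumes L: "subfield L complex_ring"
begin

lemma polys_over_closed:
  "p \<in> polys_over L \<Longrightarrow> q \<in> polys_over L \<Longrightarrow> p + q \<in> polys_over L"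
  "p \<in> polys_over L \<Longrightarrow> q \<in> polys_over L \<Longrightarrow> p - q \<in> polys_over L"
  "p \<in> polys_over L \<Longrightarrow> q \<in> polys_over L \<Longrightarrow> p * q \<in> polys_over L"
  "p \<in> polys_over L \<Longrightarrow> - p \<in> polys_over L"
  "c \<in> L \<Longrightarrow> p \<in> polys_over L \<Longrightarrow> smult c p \<in> polys_over L"
  "c \<in> L \<Longrightarrow> monom c n \<in> polys_over L"
  "c \<in> L \<Longrightarrow> p \<in> polys_over L \<Longrightarrow> pCons c p \<in> polys_over L"
  "0 \<in> polys_over L" "1 \<in> polys_over L"
  "p \<in> polys_over L \<Longrightarrow> pderiv p \<in> polys_over L"
  using subfield_closed[OF L]
  by (auto simp: polys_over_def coeff_mult coeff_pCons coeff_pderiv 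
      intro!: subfield_sum[OF L] subfield_of_nat[OF L] subfield_closed(3,4)[OF L] split: nat.split)

lemma poly_mem: "p \<in> polys_over L \<Longrightarrow> x \<in> L \<Longrightarrow> poly p x \<in> L"
  by (auto simp: poly_altdef polys_over_def
      intro!: subfield_sum[OF L] subfield_closed(4)[OF L] subfield_power[OF L])

text \<open>Long division: each step divides only by the leading coefficient of \<open>g\<close>,
  and \<open>L\<close> is a field, so quotient and remainder never leave \<open>L\<close>.\<close>

lemma polys_over_division:
  assumes "p \<in> polys_over L" "g \<in> polys_over L" "g \<noteq> 0"
  obtains q r where "q \<in> polys_over L" "r \<in> polys_over L" "p = g * q + r"
    "r = 0 \<or> degree r < degree g"
proof -
  have "\<exists>q\<in>polys_over L. \<exists>r\<in>polys_over L. p = g * q + r \<and> (r = 0 \<or> degree r < degree g)"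
    using assms(1)
  proof (induction "degree p" arbitrary: p rule: less_induct)
    case less
    show ?case
    proof (cases "p = 0 \<or> degree p < degree g")
      case True
      with less.prems show ?thesis
        by (intro bexI[of _ 0] bexI[of _ p]) (auto intro: polys_over_closed)
    next
      case False
      define t where "t = monom (lead_coeff p / lead_coeff g) (degree p - degree g)"
      have t: "t \<in> polys_over L"
        unfolding t_def using less.prems assms(2)
        by (intro polys_over_closed subfield_closed(8)[OF L] polys_over_coeff)
      have tg: "degree (g * t) = degree p"
        using False assms(3)
        by (auto simp: t_def degree_mult_eq degree_monom_eq)
      have "lead_coeff (g * t) = lead_coeff p"
        using False assms(3) unfolding lead_coeff_mult
        by (simp add: t_def degree_monom_eq)
      note tg = tg this
      define p' where "p' = p - g * t"
      have p': "p' \<in> polys_over L"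
        unfolding p'_def using less.prems assms(2) t by (intro polys_over_closed)
      \<comment> \<open>Cancelling the leading term lowers the degree, except when \<open>p\<close>
        is constant. Then \<open>g\<close> is constant too and nothing is left.\<close>
      have "p' = 0 \<or> degree p' < degree p"
      proof (cases "degree p = 0")
        case True
        then show ?thesis
          using tg unfolding p'_def
          by (metis degree_diff_le diff_self le_zero_eq coeff_diff leading_coeff_0_iff order_refl)
      next
        case False
        have "degree p' \<le> degree p"
          unfolding p'_def by (intro degree_diff_le) (auto simp: tg)
        moreover have "coeff p' (degree p) = 0"
          using tg by (simp add: p'_def)
        ultimately show ?thesis
          using leading_coeff_0_iff[of p'] by (metis le_neq_implies_less)
      qed
      then have "\<exists>q\<in>polys_over L. \<exists>r\<in>polys_over L. p' = g * q + r \<and> (r = 0 \<or> degree r < degree g)"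
      proof
        assume "p' = 0"
        then show ?thesis
          using polys_over_closed(8) by (intro bexI[of _ 0]) auto
      qed (rule less.hyps[OF _ p'])
      then obtain q r where "q \<in> polys_over L" "r \<in> polys_over L" "p' = g * q + r"
        "r = 0 \<or> degree r < degree g"
        by blast
      then show ?thesis
        using t by (intro bexI[of _ "q + t"] bexI[of _ r])
          (auto intro: polys_over_closed simp: p'_def algebra_simps)
    qed
  qed
  then show thesis using that by blast
qed

text \<open>The remainder on division by \<open>f\<close> vanishes at \<alpha> and has smaller
  degree than \<open>f\<close>, so minimality forces it to be zero.\<close>

lemma min_poly_dvd:
  assumes f: "is_min_poly L \<alpha> f" and p: "p \<in> polys_over L" "poly p \<alpha> = 0"
  obtains q where "q \<in> polys_over L" "p = f * q"
proof -
  have f': "f \<in> polys_over L" "f \<noteq> 0" "poly f \<alpha> = 0"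
    using f by (auto simp: is_min_poly_def polys_over_def)
  then obtain q r where qr: "q \<in> polys_over L" "r \<in> polys_over L" "p = f * q + r"
    "r = 0 \<or> degree r < degree f"
    using polys_over_division[OF p(1) f'(1)] by metis
  moreover have "poly r \<alpha> = 0"
    using qr(3) f'(3) p(2) by simp
  ultimately have "r = 0"
    using f unfolding is_min_poly_def polys_over_def by fastforce
  with qr that show thesis by simp
qed

lemma min_poly_exists:
  assumes "p \<in> polys_over L" "p \<noteq> 0" "poly p \<alpha> = 0"
  shows "\<exists>f. is_min_poly L \<alpha> f"
proof -
  define P where "P p \<longleftrightarrow> p \<in> polys_over L \<and> p \<noteq> 0 \<and> poly p \<alpha> = 0" for p
  define g where "g = arg_min degree P"
  have g: "P g" and min: "\<And>q. P q \<Longrightarrow> degree g \<le> degree q"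
    unfolding g_def using assms arg_min_nat_lemma[of P p degree] by (auto simp: P_def)
  have "lead_coeff g \<in> L" "lead_coeff g \<noteq> 0"
    using g by (auto simp: P_def polys_over_def)
  then have "is_min_poly L \<alpha> (smult (inverse (lead_coeff g)) g)"
    using g min unfolding is_min_poly_def P_def
    by (auto simp: polys_over_def intro!: subfield_closed[OF L])
  then show ?thesis ..
qed

lemma min_poly_degree_pos: "is_min_poly L \<alpha> f \<Longrightarrow> degree f > 0"
  by (rule ccontr) (auto simp: is_min_poly_def elim!: degree_eq_zeroE)

section \<open>Simple extensions as sets of polynomial values\<close>

lemma adjoin_mem: "\<alpha> \<in> adjoin L \<alpha>"
  unfolding adjoin_def
  by (rule image_eqI[of _ _ "[:0, 1:]"]) (auto intro!: polys_over_closed subfield_closed[OF L])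

lemma subset_adjoin: "L \<subseteq> adjoin L \<alpha>"
  unfolding adjoin_def
  by (auto intro!: image_eqI[of _ _ "[:a:]" for a] polys_over_closed)

lemma adjoin_subset:
  assumes "subfield E complex_ring" "L \<subseteq> E" "\<alpha> \<in> E"
  shows "adjoin L \<alpha> \<subseteq> E"
proof -
  have "poly p \<alpha> \<in> E" if "p \<in> polys_over L" for p
    using assms that
    by (auto simp: poly_altdef polys_over_def
        intro!: subfield_sum subfield_closed(4) subfield_power)
  then show ?thesis by (auto simp: adjoin_def)
qed

text \<open>Dividing \<open>f\<close> by \<open>p\<close> gives \<open>f = p * s + r\<close>, so at
  \<alpha> the value of \<open>r\<close> is minus the product of the values of \<open>p\<close> and
  \<open>s\<close>. An inverse for \<open>r\<close>, which has smaller degree, therefore yields one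
  for \<open>p\<close>.\<close>

lemma adjoin_inverse:
  assumes f: "is_min_poly L \<alpha> f" and p: "p \<in> polys_over L" "poly p \<alpha> \<noteq> 0" "degree p < degree f"
  shows "inverse (poly p \<alpha>) \<in> adjoin L \<alpha>"
  using p
proof (induction "degree p" arbitrary: p rule: less_induct)
  case less
  have f': "f \<in> polys_over L" "f \<noteq> 0" "poly f \<alpha> = 0"
    and min: "\<And>q. q \<in> polys_over L \<Longrightarrow> q \<noteq> 0 \<Longrightarrow> poly q \<alpha> = 0 \<Longrightarrow> degree f \<le> degree q"
    using f by (auto simp: is_min_poly_def polys_over_def)
  show ?case
  proof (cases "degree p = 0")
    case True
    then obtain c where "p = [:c:]" by (auto elim: degree_eq_zeroE)
    moreover from this have "inverse c \<in> L"
      using less.prems(1) polys_over_coeff[of p L 0] by (auto intro: subfield_closed(7)[OF L])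
    ultimately show ?thesis
      using subset_adjoin by auto
  next
    case False
    from less.prems have "p \<noteq> 0" by auto
    then obtain s r where sr: "s \<in> polys_over L" "r \<in> polys_over L" "f = p * s + r"
      "r = 0 \<or> degree r < degree p"
      using polys_over_division[OF f'(1) less.prems(1)] by metis
    have r\<alpha>: "poly r \<alpha> = - poly p \<alpha> * poly s \<alpha>"
      using sr(3) f'(3) by (simp add: eq_neg_iff_add_eq_0 add.commute)
    \<comment> \<open>Otherwise \<open>r = 0\<close>, and \<open>f = p * s\<close> is a proper
      factorisation. Since \<open>p\<close> does not vanish at \<alpha>, the factor \<open>s\<close>
      does, although its degree is below that of \<open>f\<close>.\<close>
    have "poly r \<alpha> \<noteq> 0"
    proof
      assume r0: "poly r \<alpha> = 0"
      have "r = 0"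
        using min[OF sr(2) _ r0] sr(4) less.prems(3) by linarith
      have "poly s \<alpha> = 0" using r0 r\<alpha> less.prems(2) by simp
      moreover have "s \<noteq> 0" using sr(3) \<open>r = 0\<close> f'(2) by auto
      ultimately have "degree f \<le> degree s" using min sr(1) by blast
      moreover have "degree f = degree p + degree s"
        using sr(3) \<open>r = 0\<close> \<open>s \<noteq> 0\<close> \<open>p \<noteq> 0\<close> by (simp add: degree_mult_eq)
      ultimately show False using False by simp
    qed
    then have "inverse (poly r \<alpha>) \<in> adjoin L \<alpha>"
      using less.hyps[of r] sr less.prems(3) by (cases "r = 0") auto
    then obtain t where t: "t \<in> polys_over L" "inverse (poly r \<alpha>) = poly t \<alpha>"
      by (auto simp: adjoin_def)
    have "inverse (poly p \<alpha>) = - poly s \<alpha> * inverse (poly r \<alpha>)"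
      using r\<alpha> \<open>poly r \<alpha> \<noteq> 0\<close> by (auto simp: field_simps)
    also have "\<dots> = poly (- s * t) \<alpha>" by (simp add: t)
    finally show ?thesis
      unfolding adjoin_def using sr(1) t(1)
      by (intro image_eqI[of _ _ "- s * t"] polys_over_closed)
  qed
qed

lemma adjoin_degree_less:
  assumes "is_min_poly L \<alpha> f" "\<beta> \<in> adjoin L \<alpha>"
  obtains p where "p \<in> polys_over L" "\<beta> = poly p \<alpha>" "degree p < degree f"
proof -
  have f': "f \<in> polys_over L" "f \<noteq> 0" "poly f \<alpha> = 0"
    using assms(1) by (auto simp: is_min_poly_def polys_over_def)
  from assms(2) obtain p where p: "p \<in> polys_over L" "\<beta> = poly p \<alpha>"
    by (auto simp: adjoin_def)
  obtain q r where "q \<in> polys_over L" "r \<in> polys_over L" "p = f * q + r" "r = 0 \<or> degree r < degree f"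
    using polys_over_division[OF p(1) f'(1,2)] .
  with that[of r] p f'(3) min_poly_degree_pos[OF assms(1)] show thesis by auto
qed

lemma subfield_adjoin:
  assumes "is_min_poly L \<alpha> f"
  shows "subfield (adjoin L \<alpha>) complex_ring"
proof (rule subfield_complexI)
  show "1 \<in> adjoin L \<alpha>"
    using subset_adjoin subfield_closed[OF L] by blast
  show "a + b \<in> adjoin L \<alpha>" "a * b \<in> adjoin L \<alpha>" if "a \<in> adjoin L \<alpha>" "b \<in> adjoin L \<alpha>" for a b
    using that unfolding adjoin_def
    by (auto simp flip: poly_add poly_mult intro!: imageI polys_over_closed)
  show "- a \<in> adjoin L \<alpha>" if "a \<in> adjoin L \<alpha>" for a
    using that unfolding adjoin_def
    by (auto simp flip: poly_minus intro!: imageI polys_over_closed)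
  show "inverse a \<in> adjoin L \<alpha>" if "a \<in> adjoin L \<alpha>" "a \<noteq> 0" for a
    using that adjoin_degree_less[OF assms that(1)] adjoin_inverse[OF assms] by metis
qed

text \<open>Turns the abstractly generated field of the theorem into explicit polynomial expressions
  in the generator.\<close>

lemma generate_field_eq_adjoin:
  assumes "is_min_poly L \<alpha> f"
  shows "generate_field complex_ring (insert \<alpha> L) = adjoin L \<alpha>"
  using adjoin_mem subset_adjoin subfield_adjoin[OF assms] adjoin_subset
  by (intro field.generate_fieldI[OF complex_field, symmetric]) auto

end

subsection \<open>Embeddings\<close>

context
  fixes L :: "complex set" and \<sigma> :: "complex \<Rightarrow> complex"
  assumes L: "subfield L complex_ring" and \<sigma>: "\<sigma> \<in> embeddings L"
begin

lemma embedding_hom: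
  shows embedding_add: "a \<in> L \<Longrightarrow> b \<in> L \<Longrightarrow> \<sigma> (a + b) = \<sigma> a + \<sigma> b"
    and embedding_mult: "a \<in> L \<Longrightarrow> b \<in> L \<Longrightarrow> \<sigma> (a * b) = \<sigma> a * \<sigma> b"
    and embedding_1: "\<sigma> 1 = 1" and embedding_0: "\<sigma> 0 = 0"
    and embedding_diff: "a \<in> L \<Longrightarrow> b \<in> L \<Longrightarrow> \<sigma> (a - b) = \<sigma> a - \<sigma> b"
proof -
  note c = subfield_closed[OF L]
  have add: "\<sigma> (a + b) = \<sigma> a + \<sigma> b" if "a \<in> L" "b \<in> L" for a b
    using \<sigma> that unfolding embeddings_def ring_hom_def by simp
  show "\<sigma> (a + b) = \<sigma> a + \<sigma> b" "\<sigma> (a * b) = \<sigma> a * \<sigma> b" if "a \<in> L" "b \<in> L"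
    using \<sigma> that unfolding embeddings_def ring_hom_def by simp_all
  show "\<sigma> 1 = 1" 
    using \<sigma> unfolding embeddings_def ring_hom_def by simp
  show z: "\<sigma> 0 = 0" using add[of 0 0] c by simp
  have um: "\<sigma> (- a) = - \<sigma> a" if "a \<in> L" for a
    using add[of a "- a"] that c z by (simp add: eq_neg_iff_add_eq_0 add.commute)
  show "\<sigma> (a - b) = \<sigma> a - \<sigma> b" if "a \<in> L" "b \<in> L"
    using add[of a "- b"] um[of b] that c by simp
qed

lemma embedding_inverse:
  assumes "a \<in> L"
  shows "\<sigma> (inverse a) = inverse (\<sigma> a)"
proof (cases "a = 0")
  case False
  then have "\<sigma> a * \<sigma> (inverse a) = 1"
    using embedding_mult[of a "inverse a"] embedding_1 assms subfield_closed[OF L] by simp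
  then show ?thesis by (metis inverse_unique)
qed (simp add: embedding_0)

lemma embedding_eq_0_iff: "a \<in> L \<Longrightarrow> \<sigma> a = 0 \<longleftrightarrow> a = 0"
  using embedding_mult[of a "inverse a"] embedding_1 embedding_0 subfield_closed[OF L]
  by (cases "a = 0") auto

lemma embedding_divide: "a \<in> L \<Longrightarrow> b \<in> L \<Longrightarrow> \<sigma> (a / b) = \<sigma> a / \<sigma> b"
  using embedding_mult embedding_inverse subfield_closed[OF L] by (simp add: divide_inverse)

lemma embedding_power: "a \<in> L \<Longrightarrow> \<sigma> (a ^ n) = \<sigma> a ^ n"
  by (induction n) (simp_all add: embedding_1 embedding_mult subfield_power[OF L])

lemma embedding_sum: "(\<And>i. i \<in> A \<Longrightarrow> g i \<in> L) \<Longrightarrow> \<sigma> (sum g A) = (\<Sum>i\<in>A. \<sigma> (g i))"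
  by (induction A rule: infinite_finite_induct)
    (simp_all add: embedding_0 embedding_add subfield_sum[OF L])

lemma coeff_map_embedding: "coeff (map_poly \<sigma> p) i = \<sigma> (coeff p i)"
  by (simp add: coeff_map_poly embedding_0)

lemma degree_map_embedding: "p \<in> polys_over L \<Longrightarrow> degree (map_poly \<sigma> p) = degree p"
  by (cases "p = 0") (auto intro!: map_poly_degree_eq simp: embedding_eq_0_iff polys_over_coeff)

lemma map_embedding_hom:
  assumes "p \<in> polys_over L" "q \<in> polys_over L"
  shows map_embedding_add: "map_poly \<sigma> (p + q) = map_poly \<sigma> p + map_poly \<sigma> q"
    and map_embedding_diff: "map_poly \<sigma> (p - q) = map_poly \<sigma> p - map_poly \<sigma> q"
    and map_embedding_mult: "map_poly \<sigma> (p * q) = map_poly \<sigma> p * map_poly \<sigma> q"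
proof -
  note c = assms[THEN polys_over_coeff]
  show "map_poly \<sigma> (p + q) = map_poly \<sigma> p + map_poly \<sigma> q"
    "map_poly \<sigma> (p - q) = map_poly \<sigma> p - map_poly \<sigma> q"
    by (simp_all add: poly_eq_iff coeff_map_embedding embedding_add embedding_diff c)
  have "\<sigma> (coeff (p * q) n) = coeff (map_poly \<sigma> p * map_poly \<sigma> q) n" for n
    by (simp add: coeff_mult coeff_map_embedding embedding_sum embedding_mult c
        subfield_closed(4)[OF L])
  then show "map_poly \<sigma> (p * q) = map_poly \<sigma> p * map_poly \<sigma> q"
    by (simp add: poly_eq_iff coeff_map_embedding)
qed

lemma poly_map_embedding:
  assumes "p \<in> polys_over L" "x \<in> L"
  shows "poly (map_poly \<sigma> p) (\<sigma> x) = \<sigma> (poly p x)"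
  unfolding poly_altdef degree_map_embedding[OF assms(1)]
  using assms
  by (simp add: embedding_sum embedding_mult embedding_power coeff_map_embedding polys_over_coeff
      subfield_closed(4)[OF L] subfield_power[OF L])

lemma embedding_Rats:
  assumes "r \<in> \<rat>"
  shows "\<sigma> r = r"
proof -
  have nat: "\<sigma> (of_nat n) = of_nat n" for n
    by (induction n) (simp_all add: embedding_0 embedding_1 embedding_add subfield_of_nat[OF L]
        subfield_closed(2)[OF L])
  have int: "\<sigma> (of_int c) = of_int c" "of_int c \<in> L" for c
    by (cases c rule: int_diff_cases; 
        simp add: embedding_diff nat subfield_of_nat[OF L] subfield_closed(6)[OF L])+
  from assms obtain a b :: int where "r = of_int a / of_int b"
    by (auto elim: Rats_cases')
  then show ?thesis by (simp add: embedding_divide int)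
qed

lemma map_embedding_fixed: "(\<And>i. \<sigma> (coeff p i) = coeff p i) \<Longrightarrow> map_poly \<sigma> p = p"
  by (simp add: poly_eq_iff coeff_map_embedding)

text \<open>Such a \<open>p\<close> is a multiple of \<open>f\<close> over \<open>L\<close>, and
  \<sigma> carries the factorisation along. This takes the place of an irreducibility argument for
  \<open>map_poly \<sigma> f\<close>.\<close>

lemma map_embedding_min_poly_dvd:
  assumes "is_min_poly L \<alpha> f" "p \<in> polys_over L" "poly p \<alpha> = 0"
  shows "map_poly \<sigma> f dvd map_poly \<sigma> p"
proof -
  from assms obtain q where "q \<in> polys_over L" "p = f * q" by (rule min_poly_dvd[OF L])
  moreover have "f \<in> polys_over L" using assms by (simp add: is_min_poly_def polys_over_def)
  ultimately show ?thesis by (simp add: map_embedding_mult)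
qed

text \<open>The extension sends \<open>poly p \<alpha>\<close> to
  \<open>poly (map_poly \<sigma> p) z\<close>. Two polynomials with the same value at \<alpha>
  differ by a multiple of \<open>f\<close>, whose image vanishes at \<open>z\<close>, so this is
  well defined.\<close>

lemma embedding_extend:
  assumes f: "is_min_poly L \<alpha> f" and z: "poly (map_poly \<sigma> f) z = 0"
  obtains \<tau> where "\<tau> \<in> embeddings (adjoin L \<alpha>)" "\<And>a. a \<in> L \<Longrightarrow> \<tau> a = \<sigma> a" "\<tau> \<alpha> = z"
proof -
  \<comment> \<open>\<open>P\<close> chooses an arbitrary polynomial representing \<beta>; the next
    claim about \<tau> shows that the choice does not affect the value.\<close>
  define P where "P \<beta> = (SOME p. p \<in> polys_over L \<and> poly p \<alpha> = \<beta>)" for \<beta>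
  define \<tau> where "\<tau> = restrict (\<lambda>\<beta>. poly (map_poly \<sigma> (P \<beta>)) z) (adjoin L \<alpha>)"
  have \<tau>: "\<tau> (poly p \<alpha>) = poly (map_poly \<sigma> p) z" if p: "p \<in> polys_over L" for p
  proof -
    define q where "q = P (poly p \<alpha>)"
    have q: "q \<in> polys_over L" "poly q \<alpha> = poly p \<alpha>"
      using someI[of "\<lambda>q. q \<in> polys_over L \<and> poly q \<alpha> = poly p \<alpha>" p] p
      by (auto simp: q_def P_def)
    have "map_poly \<sigma> f dvd map_poly \<sigma> (p - q)"
      using p q by (intro map_embedding_min_poly_dvd[OF f] polys_over_closed[OF L]) auto
    then have "poly (map_poly \<sigma> (p - q)) z = 0"
      using z by (auto simp: dvd_def)
    then show ?thesis
      using p q by (simp add: \<tau>_def q_def[symmetric] map_embedding_diff adjoin_def)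
  qed
  have "\<tau> \<in> embeddings (adjoin L \<alpha>)"
  proof -
    have "\<tau> \<in> ring_hom (complex_ring\<lparr>carrier := adjoin L \<alpha>\<rparr>) complex_ring"
    proof (rule ring_hom_memI)
      show "\<tau> \<one>\<^bsub>complex_ring\<lparr>carrier := adjoin L \<alpha>\<rparr>\<^esub> = \<one>\<^bsub>complex_ring\<^esub>"
        using \<tau>[of 1] polys_over_closed(9)[OF L] by (simp add: map_poly_1 embedding_1)
    next
      fix a b
      assume "a \<in> carrier (complex_ring\<lparr>carrier := adjoin L \<alpha>\<rparr>)"
        "b \<in> carrier (complex_ring\<lparr>carrier := adjoin L \<alpha>\<rparr>)"
      then obtain p q where pq: "p \<in> polys_over L" "q \<in> polys_over L" "a = poly p \<alpha>" "b = poly q \<alpha>"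
        by (auto simp: adjoin_def)
      then have "\<tau> (a * b) = \<tau> a * \<tau> b" "\<tau> (a + b) = \<tau> a + \<tau> b"
        using \<tau>[of "p * q"] \<tau>[of "p + q"]
        by (simp_all add: \<tau> map_embedding_hom polys_over_closed[OF L])
      then show "\<tau> (a \<otimes>\<^bsub>complex_ring\<lparr>carrier := adjoin L \<alpha>\<rparr>\<^esub> b) = \<tau> a \<otimes>\<^bsub>complex_ring\<^esub> \<tau> b"
        "\<tau> (a \<oplus>\<^bsub>complex_ring\<lparr>carrier := adjoin L \<alpha>\<rparr>\<^esub> b) = \<tau> a \<oplus>\<^bsub>complex_ring\<^esub> \<tau> b"
        by simp_all
    qed auto
    then show ?thesis by (simp add: embeddings_def \<tau>_def)
  qed
  moreover have "\<tau> a = \<sigma> a" if "a \<in> L" for a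
    using \<tau>[of "[:a:]"] that
    by (simp add: polys_over_closed[OF L] map_poly_pCons embedding_0)
  moreover have "\<tau> \<alpha> = z"
    using \<tau>[of "[:0, 1:]"]
    by (simp add: polys_over_closed[OF L] subfield_closed[OF L] map_poly_pCons embedding_0 embedding_1)
  ultimately show thesis using that by blast
qed

lemma embedding_restrict:
  assumes "E \<subseteq> L" "subfield E complex_ring"
  shows "restrict \<sigma> E \<in> embeddings E"
proof -
  have "restrict \<sigma> E \<in> ring_hom (complex_ring\<lparr>carrier := E\<rparr>) complex_ring"
    using assms(1) subfield_closed[OF assms(2)]
    by (intro ring_hom_memI) (auto simp: subset_iff embedding_hom)
  then show ?thesis by (simp add: embeddings_def)
qed

end

lemma embeddings_id: "subfield L complex_ring \<Longrightarrow> restrict (\<lambda>x. x) L \<in> embeddings L"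
  unfolding embeddings_def by (auto intro!: ring_hom_memI intro: subfield_closed)

lemma map_poly_embeddings_id:
  assumes "subfield L complex_ring" "f \<in> polys_over L"
  shows "map_poly (restrict (\<lambda>x. x) L) f = f"
  using assms(2) by (intro map_embedding_fixed[OF assms(1) embeddings_id[OF assms(1)]])
    (simp add: polys_over_coeff)

text \<open>Every element is a polynomial in \<alpha> over \<open>L\<close>, so its image is
  determined by the images of \<open>L\<close> and \<alpha>; extensionality settles the arguments
  outside the field.\<close>

lemma embedding_adjoin_eqI:
  assumes L: "subfield L complex_ring" and f: "is_min_poly L \<alpha> f"
    and \<tau>: "\<tau> \<in> embeddings (adjoin L \<alpha>)" "\<tau>' \<in> embeddings (adjoin L \<alpha>)"
    and eq: "\<And>a. a \<in> L \<Longrightarrow> \<tau> a = \<tau>' a" "\<tau> \<alpha> = \<tau>' \<alpha>"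
  shows "\<tau> = \<tau>'"
proof (rule extensionalityI)
  show "\<tau> \<in> extensional (adjoin L \<alpha>)" "\<tau>' \<in> extensional (adjoin L \<alpha>)"
    using \<tau> by (auto simp: embeddings_def)
  note E = subfield_adjoin[OF L f]
  fix \<beta> assume "\<beta> \<in> adjoin L \<alpha>"
  then obtain p where p: "p \<in> polys_over L" "\<beta> = poly p \<alpha>" by (auto simp: adjoin_def)
  have p': "p \<in> polys_over (adjoin L \<alpha>)"
    using p polys_over_mono[OF subset_adjoin[OF L]] by blast
  have "map_poly \<tau> p = map_poly \<tau>' p"
    using eq(1) p(1) \<tau> by (simp add: poly_eq_iff coeff_map_embedding[OF E] polys_over_coeff)
  then have "poly (map_poly \<tau> p) (\<tau> \<alpha>) = poly (map_poly \<tau>' p) (\<tau>' \<alpha>)"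
    using eq by simp
  then show "\<tau> \<beta> = \<tau>' \<beta>"
    using p p' \<tau> adjoin_mem[OF L] by (simp add: poly_map_embedding[OF E])
qed

subsection \<open>Finite extensions\<close>

text \<open>Under the degree hypothesis the powers of \<alpha> below the \<open>n\<close>-th are
  linearly independent, and the induction adjoins them one at a time. Phrasing the degree bound by
  vanishing coefficients lets \<open>n = 0\<close> give exactly the zero polynomial.\<close>

lemma dimension_polys_degree_less:
  assumes L: "subfield L complex_ring"
    and min: "\<And>q. q \<in> polys_over L \<Longrightarrow> q \<noteq> 0 \<Longrightarrow> poly q \<alpha> = 0 \<Longrightarrow> n \<le> degree q"
  shows "ring.dimension complex_ring n L
    ((\<lambda>p. poly p \<alpha>) ` {p \<in> polys_over L. \<forall>i\<ge>n. coeff p i = 0})"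
  using min
proof (induction n)
  case 0
  have "{p \<in> polys_over L. \<forall>i\<ge>0. coeff p i = 0} = {0}"
    using polys_over_closed(8)[OF L] by (auto simp: poly_eq_iff)
  then show ?case using complex_ring.zero_dim[of L] by simp
next
  case (Suc n)
  let ?E = "\<lambda>n. (\<lambda>p. poly p \<alpha>) ` {p \<in> polys_over L. \<forall>i\<ge>n. coeff p i = 0}"
  have IH: "ring.dimension complex_ring n L (?E n)"
    using Suc.prems by (intro Suc.IH) (meson Suc_leD)
  \<comment> \<open>A representation of \<open>\<alpha> ^ n\<close> by lower powers would give a
    monic polynomial of degree \<open>n\<close> vanishing at \<alpha>, whereas such degrees are at
    least \<open>Suc n\<close>.\<close>
  have "\<alpha> ^ n \<notin> ?E n"
  proof
    assume "\<alpha> ^ n \<in> ?E n"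
    then obtain p where p: "p \<in> polys_over L" "\<And>i. i \<ge> n \<Longrightarrow> coeff p i = 0" "poly p \<alpha> = \<alpha> ^ n"
      by force
    define q where "q = monom 1 n - p"
    have "coeff q n = 1" using p(2) by (simp add: q_def)
    then have "q \<noteq> 0" by auto
    have "degree q \<le> n"
      by (rule degree_le) (use p(2) in \<open>auto simp: q_def\<close>)
    moreover have "q \<in> polys_over L"
      unfolding q_def using p(1) L by (intro polys_over_closed subfield_closed) auto
    ultimately show False
      using Suc.prems[of q] \<open>q \<noteq> 0\<close> p(3) by (simp add: q_def poly_monom)
  qed
  then have "ring.dimension complex_ring (Suc n) L (complex_ring.line_extension L (\<alpha> ^ n) (?E n))"
    using IH by (intro complex_ring.Suc_dim) auto
  also have "complex_ring.line_extension L (\<alpha> ^ n) (?E n) = ?E (Suc n)"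
  proof (intro equalityI subsetI)
    fix u assume "u \<in> complex_ring.line_extension L (\<alpha> ^ n) (?E n)"
    then obtain k p where kp: "k \<in> L" "p \<in> polys_over L" "\<And>i. i \<ge> n \<Longrightarrow> coeff p i = 0"
      "u = k * \<alpha> ^ n + poly p \<alpha>"
      unfolding complex_ring.line_extension_mem_iff by auto
    then show "u \<in> ?E (Suc n)"
      by (intro image_eqI[of _ _ "monom k n + p"]) (auto simp: poly_monom intro: polys_over_closed[OF L])
  next
    fix u assume "u \<in> ?E (Suc n)"
    then obtain p where p: "p \<in> polys_over L" "\<And>i. i \<ge> Suc n \<Longrightarrow> coeff p i = 0" "u = poly p \<alpha>"
      by auto
    define q where "q = p - monom (coeff p n) n"
    have "q \<in> polys_over L"
      unfolding q_def using p(1) by (intro polys_over_closed[OF L] polys_over_coeff)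
    moreover have "coeff q i = 0" if "i \<ge> n" for i
      using p(2)[of i] that by (cases "i = n") (auto simp: q_def)
    ultimately have "poly q \<alpha> \<in> ?E n" by auto
    moreover have "u = coeff p n * \<alpha> ^ n + poly q \<alpha>"
      by (simp add: q_def p(3) poly_monom)
    ultimately show "u \<in> complex_ring.line_extension L (\<alpha> ^ n) (?E n)"
      unfolding complex_ring.line_extension_mem_iff using polys_over_coeff[OF p(1), of n]
      by (intro bexI[of _ "coeff p n"] bexI[of _ "poly q \<alpha>"]) auto
  qed
  finally show ?case .
qed

text \<open>Reduction modulo \<open>f\<close> leaves only polynomials of degree below
  \<open>degree f\<close>. This is what identifies the extension degree with
  \<open>degree f\<close>.\<close>

lemma dimension_adjoin:
  assumes L: "subfield L complex_ring" and f: "is_min_poly L \<alpha> f"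
  shows "ring.dimension complex_ring (degree f) L (adjoin L \<alpha>)"
proof -
  have "adjoin L \<alpha> = (\<lambda>p. poly p \<alpha>) ` {p \<in> polys_over L. \<forall>i\<ge>degree f. coeff p i = 0}"
  proof (intro equalityI subsetI)
    fix \<beta> assume "\<beta> \<in> adjoin L \<alpha>"
    then obtain p where "p \<in> polys_over L" "\<beta> = poly p \<alpha>" "degree p < degree f"
      using adjoin_degree_less[OF L f] by blast
    then show "\<beta> \<in> (\<lambda>p. poly p \<alpha>) ` {p \<in> polys_over L. \<forall>i\<ge>degree f. coeff p i = 0}"
      by (intro image_eqI[of _ _ p]) (auto intro: coeff_eq_0)
  qed (auto simp: adjoin_def)
  moreover have "degree f \<le> degree q" if "q \<in> polys_over L" "q \<noteq> 0" "poly q \<alpha> = 0" for q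
    using f that by (auto simp: is_min_poly_def polys_over_def)
  ultimately show ?thesis using dimension_polys_degree_less[OF L, of \<alpha> "degree f"] by simp
qed

text \<open>For a transcendental \<open>x\<close> the first \<open>Suc n\<close> powers would be
  independent, too many for a space of dimension \<open>n\<close>.\<close>

lemma finite_dimension_algebraic:
  assumes L: "subfield L complex_ring" "subfield M complex_ring" "L \<subseteq> M"
    and dim: "ring.dimension complex_ring n L M" and "x \<in> M"
  obtains p where "p \<in> polys_over L" "p \<noteq> 0" "poly p x = 0"
proof -
  have "\<exists>p\<in>polys_over L. p \<noteq> 0 \<and> poly p x = 0"
  proof (rule ccontr)
    assume "\<not> ?thesis"
    \<comment> \<open>The degree hypothesis of \<open>dimension_polys_degree_less\<close> holds
      vacuously here: no nonzero polynomial over \<open>L\<close> vanishes at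
      \<open>x\<close>.\<close>
    then have "ring.dimension complex_ring (Suc n) L
      ((\<lambda>p. poly p x) ` {p \<in> polys_over L. \<forall>i\<ge>Suc n. coeff p i = 0})" (is "complex_ring.dimension _ _ ?E")
      by (intro dimension_polys_degree_less[OF L(1)]) auto
    then obtain Vs where Vs: "complex_ring.independent L Vs" "length Vs = Suc n"
      "complex_ring.Span L Vs = ?E"
      using complex_ring.exists_base[OF L(1)] by blast
    have "?E \<subseteq> M"
      using L(3) assms(5) poly_mem[OF L(2)] polys_over_mono[OF L(3)] by auto
    moreover have "set Vs \<subseteq> ?E"
      using complex_ring.Span_base_incl[OF L(1), of Vs] Vs(3) by simp
    ultimately have "length Vs \<le> n"
      by (intro complex_ring.independent_length_le_dimension[OF L(1) dim Vs(1)]) (rule order_trans)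
    then show False using Vs(2) by simp
  qed
  then show thesis using that by blast
qed

text \<open>The elements of \<open>Vs\<close> are adjoined in turn. An extension exists at each step
  because the image of the minimal polynomial has a root in the complex numbers.\<close>

lemma embedding_extend_list:
  assumes "subfield L complex_ring" "\<sigma> \<in> embeddings L"
    and "\<And>v. v \<in> set Vs \<Longrightarrow> \<exists>p\<in>polys_over L. p \<noteq> 0 \<and> poly p v = 0"
  shows "\<exists>E \<tau>. subfield E complex_ring \<and> L \<subseteq> E \<and> set Vs \<subseteq> E \<and> \<tau> \<in> embeddings E \<and> (\<forall>a\<in>L. \<tau> a = \<sigma> a)"
  using assms
proof (induction Vs arbitrary: L \<sigma>)
  case (Cons v Vs)
  note L = Cons.prems(1) and \<sigma> = Cons.prems(2)
  from Cons.prems(3)[of v] obtain f where f: "is_min_poly L v f"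
    using min_poly_exists[OF L] by auto
  then have f': "f \<in> polys_over L" by (simp add: is_min_poly_def polys_over_def)
  have "degree (map_poly \<sigma> f) \<noteq> 0"
    using min_poly_degree_pos[OF L f] degree_map_embedding[OF L \<sigma> f'] by simp
  then obtain z where "poly (map_poly \<sigma> f) z = 0"
    using fundamental_theorem_of_algebra[of "map_poly \<sigma> f"] by (auto simp: constant_degree)
  then obtain \<tau> where \<tau>: "\<tau> \<in> embeddings (adjoin L v)" "\<And>a. a \<in> L \<Longrightarrow> \<tau> a = \<sigma> a"
    using embedding_extend[OF L \<sigma> f] by metis
  have sub: "L \<subseteq> adjoin L v" by (rule subset_adjoin[OF L])
  have "\<exists>E \<tau>'. subfield E complex_ring \<and> adjoin L v \<subseteq> E \<and> set Vs \<subseteq> E \<and> \<tau>' \<in> embeddings E \<and>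
      (\<forall>a\<in>adjoin L v. \<tau>' a = \<tau> a)"
    using Cons.prems(3) polys_over_mono[OF sub]
    by (intro Cons.IH[OF subfield_adjoin[OF L f] \<tau>(1)]) (meson list.set_intros(2) subsetD)
  then obtain E \<tau>' where "subfield E complex_ring" "adjoin L v \<subseteq> E" "set Vs \<subseteq> E" "\<tau>' \<in> embeddings E"
      "\<forall>a\<in>adjoin L v. \<tau>' a = \<tau> a" by blast
  then show ?case
    using sub \<tau>(2) adjoin_mem[OF L, of v]
    by (intro exI[of _ E] exI[of _ \<tau>']) auto
qed auto

lemma Span_subset_subfield:
  assumes "subfield E complex_ring" "L \<subseteq> E" "set Vs \<subseteq> E"
  shows "complex_ring.Span L Vs \<subseteq> E"
  using assms(3)
proof (induction Vs)
  case (Cons v Vs)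
  then show ?case
    using assms(2) subfield_closed(3,4)[OF assms(1)]
    by (auto simp: complex_ring.line_extension_mem_iff subset_iff)
qed (simp add: subfield_closed(1)[OF assms(1)])

text \<open>This is \<open>embedding_extend\<close> applied to the inclusion of \<open>L\<close>,
  which must be written as a restricted identity to be extensional.\<close>

lemma embedding_fixing:
  assumes L: "subfield L complex_ring" and f: "is_min_poly L \<alpha> f" and z: "poly f z = 0"
  obtains \<tau> where "\<tau> \<in> embeddings (adjoin L \<alpha>)" "\<And>a. a \<in> L \<Longrightarrow> \<tau> a = a" "\<tau> \<alpha> = z"
proof -
  note id = embeddings_id[OF L]
  have "map_poly (restrict (\<lambda>x. x) L) f = f"
    using f by (intro map_poly_embeddings_id[OF L]) (simp add: is_min_poly_def polys_over_def)
  with z have "poly (map_poly (restrict (\<lambda>x. x) L) f) z = 0" by simp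
  then obtain \<tau> where "\<tau> \<in> embeddings (adjoin L \<alpha>)"
    "\<And>a. a \<in> L \<Longrightarrow> \<tau> a = restrict (\<lambda>x. x) L a" "\<tau> \<alpha> = z"
    using embedding_extend[OF L id f] by blast
  with that[of \<tau>] show thesis by simp
qed

text \<open>Sending \<open>x\<close> to \<open>z\<close> defines an embedding of
  \<open>adjoin \<rat> x\<close>. Adjoining a rational basis of \<open>M\<close> extends it to a
  field containing \<open>M\<close>, and restricting to \<open>M\<close> gives \<sigma>.\<close>

lemma conjugate_eq_embedding:
  assumes M: "subfield M complex_ring" and dim: "ring.dimension complex_ring n \<rat> M"
    and x: "x \<in> M" and z: "z \<in> conjugates x"
  obtains \<sigma> where "\<sigma> \<in> embeddings M" "\<sigma> x = z"
proof -
  note Q = subfield_Rats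
  obtain Vs where Vs: "set Vs \<subseteq> M" "complex_ring.Span \<rat> Vs = M"
    using complex_ring.exists_base[OF Q dim] complex_ring.Span_base_incl[OF Q] by blast
  from z obtain f where f: "is_min_poly \<rat> x f" "poly f z = 0" by (auto simp: conjugates_def)
  obtain \<tau> where \<tau>: "\<tau> \<in> embeddings (adjoin \<rat> x)" "\<tau> x = z"
    using embedding_fixing[OF Q f] by blast
  have "\<exists>p\<in>polys_over (adjoin \<rat> x). p \<noteq> 0 \<and> poly p v = 0" if "v \<in> set Vs" for v
    using finite_dimension_algebraic[OF Q M Rats_subset_subfield[OF M] dim, of v] that Vs(1)
      polys_over_mono[OF subset_adjoin[OF Q, of x]] by (metis subsetD)
  from embedding_extend_list[OF subfield_adjoin[OF Q f(1)] \<tau>(1) this]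
  obtain E \<tau>' where E: "subfield E complex_ring" "adjoin \<rat> x \<subseteq> E" "set Vs \<subseteq> E"
    and \<tau>': "\<tau>' \<in> embeddings E" "\<And>a. a \<in> adjoin \<rat> x \<Longrightarrow> \<tau>' a = \<tau> a"
    by blast
  have "M \<subseteq> E"
    using Span_subset_subfield[OF E(1) Rats_subset_subfield[OF E(1)] E(3)] Vs(2) by simp
  then have "restrict \<tau>' M \<in> embeddings M"
    using embedding_restrict[OF E(1) \<tau>'(1)] M by blast
  moreover have "restrict \<tau>' M x = z"
    using \<tau>'(2)[OF adjoin_mem[OF Q]] \<tau>(2) x by simp
  ultimately show thesis using that by blast
qed

subsection \<open>The relative norm\<close>

text \<open>At a multiple root \<open>z\<close>, the embedding over \<open>L\<close> taking \<alpha>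
  to \<open>z\<close> sends \<open>poly (pderiv f) \<alpha>\<close> to 0. By injectivity
  \<open>pderiv f\<close> vanishes at \<alpha>; it is nonzero in characteristic 0, contradicting
  minimality of the degree.\<close>

lemma min_poly_rsquarefree:
  assumes L: "subfield L complex_ring" and f: "is_min_poly L \<alpha> f"
  shows "rsquarefree f"
  unfolding rsquarefree_roots
proof (intro allI notI)
  fix z assume z: "poly f z = 0 \<and> poly (pderiv f) z = 0"
  have f': "f \<in> polys_over L" "pderiv f \<in> polys_over L"
    using f polys_over_closed(10)[OF L] by (auto simp: is_min_poly_def polys_over_def)
  have deg: "degree f > 0" by (rule min_poly_degree_pos[OF L f])
  obtain \<tau> where \<tau>: "\<tau> \<in> embeddings (adjoin L \<alpha>)" "\<And>a. a \<in> L \<Longrightarrow> \<tau> a = a" "\<tau> \<alpha> = z"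
    using embedding_fixing[OF L f] z by blast
  note E = subfield_adjoin[OF L f]
  have "map_poly \<tau> (pderiv f) = pderiv f"
    using f' \<tau>(2) by (intro map_embedding_fixed[OF E \<tau>(1)]) (simp add: polys_over_coeff)
  then have "\<tau> (poly (pderiv f) \<alpha>) = 0"
    using poly_map_embedding[OF E \<tau>(1), of "pderiv f" \<alpha>] f'(2) polys_over_mono[OF subset_adjoin[OF L]]
      adjoin_mem[OF L] \<tau>(3) z by (metis subsetD)
  moreover have "poly (pderiv f) \<alpha> \<in> adjoin L \<alpha>" using f'(2) by (simp add: adjoin_def)
  ultimately have "poly (pderiv f) \<alpha> = 0"
    using embedding_eq_0_iff[OF E \<tau>(1)] by blast
  moreover have "pderiv f \<noteq> 0" using deg by (simp add: pderiv_eq_0_iff)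
  ultimately have "degree f \<le> degree (pderiv f)"
    using f f'(2) by (auto simp: is_min_poly_def polys_over_def)
  then show False using deg by (simp add: degree_pderiv)
qed

text \<open>Evaluation at \<alpha> is a bijection from the embeddings fixing \<open>L\<close> onto
  the roots of \<open>f\<close>, so the norm can be reindexed by roots.\<close>

lemma rel_norm_eq_prod:
  assumes L: "subfield L complex_ring" and f: "is_min_poly L \<alpha> f" and xy: "x \<in> L" "y \<in> L"
  shows "rel_norm L (adjoin L \<alpha>) (x - \<alpha> * y) = (\<Prod>z | poly f z = 0. x - z * y)"
proof -
  let ?T = "{\<tau> \<in> embeddings (adjoin L \<alpha>). \<forall>a\<in>L. \<tau> a = a}"
  note E = subfield_adjoin[OF L f]
  have f': "f \<in> polys_over L" "poly f \<alpha> = 0" using f by (auto simp: is_min_poly_def polys_over_def)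
  note sub = subset_adjoin[OF L, of \<alpha>] and \<alpha> = adjoin_mem[OF L, of \<alpha>]
  have "bij_betw (\<lambda>\<tau>. \<tau> \<alpha>) ?T {z. poly f z = 0}"
    unfolding bij_betw_def
  proof (intro conjI equalityI subsetI)
    show "inj_on (\<lambda>\<tau>. \<tau> \<alpha>) ?T"
    proof (rule inj_onI)
      fix \<tau> \<tau>'
      assume "\<tau> \<in> ?T" "\<tau>' \<in> ?T" "\<tau> \<alpha> = \<tau>' \<alpha>"
      then show "\<tau> = \<tau>'"
        by (intro embedding_adjoin_eqI[OF L f]) simp_all
    qed
    fix z assume "z \<in> (\<lambda>\<tau>. \<tau> \<alpha>) ` ?T"
    then obtain \<tau> where \<tau>: "\<tau> \<in> embeddings (adjoin L \<alpha>)" "\<forall>a\<in>L. \<tau> a = a" "z = \<tau> \<alpha>" by auto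
    have "map_poly \<tau> f = f"
      using f' \<tau>(2) by (intro map_embedding_fixed[OF E \<tau>(1)]) (simp add: polys_over_coeff)
    then have "poly f z = \<tau> (poly f \<alpha>)"
      using poly_map_embedding[OF E \<tau>(1), of f \<alpha>] f' polys_over_mono[OF sub] \<alpha> \<tau>(3) by auto
    then show "z \<in> {z. poly f z = 0}" using f'(2) embedding_0[OF E \<tau>(1)] by simp
  next
    fix z assume z: "z \<in> {z. poly f z = 0}"
    then obtain \<tau> where "\<tau> \<in> embeddings (adjoin L \<alpha>)" "\<And>a. a \<in> L \<Longrightarrow> \<tau> a = a" "\<tau> \<alpha> = z"
      using embedding_fixing[OF L f, of z] by blast
    then show "z \<in> (\<lambda>\<tau>. \<tau> \<alpha>) ` ?T" by auto
  qed
  then have "(\<Prod>z | poly f z = 0. x - z * y) = (\<Prod>\<tau>\<in>?T. x - \<tau> \<alpha> * y)"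
    by (rule prod.reindex_bij_betw[symmetric])
  also have "\<dots> = (\<Prod>\<tau>\<in>?T. \<tau> (x - \<alpha> * y))"
  proof (intro prod.cong refl)
    fix \<tau> assume "\<tau> \<in> ?T"
    then have \<tau>: "\<tau> \<in> embeddings (adjoin L \<alpha>)" and fxy: "\<tau> x = x" "\<tau> y = y" using xy by auto
    have "x \<in> adjoin L \<alpha>" "y \<in> adjoin L \<alpha>" using sub xy by auto
    then show "x - \<tau> \<alpha> * y = \<tau> (x - \<alpha> * y)"
      by (simp add: embedding_diff[OF E \<tau>] embedding_mult[OF E \<tau>] \<alpha> subfield_closed(4)[OF E] fxy)
  qed
  finally show ?thesis by (simp add: rel_norm_def)
qed

text \<open>The roots of \<open>f\<close> need not lie in \<open>L\<close>, so an embedding of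
  \<open>L\<close> cannot be applied to the product over them. The homogenised form only involves
  elements of \<open>L\<close>.\<close>

lemma rel_norm_linear:
  assumes L: "subfield L complex_ring" and f: "is_min_poly L \<alpha> f" and xy: "x \<in> L" "y \<in> L"
  shows "rel_norm L (adjoin L \<alpha>) (x - \<alpha> * y) =
    (if y = 0 then x ^ degree f else y ^ degree f * poly f (x / y))"
proof -
  have f0: "f \<noteq> 0" and monic: "lead_coeff f = 1" using f by (auto simp: is_min_poly_def)
  have dec: "(\<Prod>z | poly f z = 0. [:- z, 1:]) = f"
    using complex_poly_decompose_rsquarefree[OF min_poly_rsquarefree[OF L f]] monic by simp
  \<comment> \<open>The roots are simple, so comparing degrees in the factorisation counts
    them.\<close>
  have "degree (\<Prod>z | poly f z = 0. [:- z, 1:]) = card {z. poly f z = 0}"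
    by (subst degree_prod_eq_sum_degree) simp_all
  then have card: "card {z. poly f z = 0} = degree f" by (simp add: dec)
  show ?thesis
  proof (cases "y = 0")
    case True
    then show ?thesis using rel_norm_eq_prod[OF assms] card by simp
  next
    case False
    have "(\<Prod>z | poly f z = 0. x - z * y) = (\<Prod>z | poly f z = 0. y * (x / y - z))"
      using False by (simp add: field_simps)
    also have "\<dots> = y ^ degree f * (\<Prod>z | poly f z = 0. x / y - z)"
      by (simp add: prod.distrib card)
    also have "(\<Prod>z | poly f z = 0. x / y - z) = poly (\<Prod>z | poly f z = 0. [:- z, 1:]) (x / y)"
      by (simp add: poly_prod)
    finally show ?thesis using False rel_norm_eq_prod[OF assms] by (simp add: dec)
  qed
qed

section \<open>Small linear factors of the norm\<close>

lemma monic_poly_eq_prod: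
  fixes p :: "complex poly"
  assumes "lead_coeff p = 1"
  obtains root where "\<And>u. poly p u = (\<Prod>i<degree p. u - root i)"
proof -
  \<comment> \<open>Roots are listed with multiplicity, so that the lemma also covers
    \<open>map_poly \<sigma> f\<close>, for which simplicity of the roots is not
    established.\<close>
  obtain root where "smult (lead_coeff p) (\<Prod>i<degree p. [:- root i, 1:]) = p"
    by (rule complex_poly_decompose')
  then have p: "p = (\<Prod>i<degree p. [:- root i, 1:])" using assms by simp
  have "poly p u = (\<Prod>i<degree p. u - root i)" for u
    by (subst p) (simp add: poly_prod)
  then show thesis by (rule that)
qed

text \<open>The value of \<open>p\<close> at \<open>w\<close> has modulus the product of the
  distances from \<open>w\<close> to the roots, and each factor is at least the smallest
  one.\<close>

lemma monic_poly_nearest_root: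
  fixes p :: "complex poly"
  assumes "lead_coeff p = 1" "degree p > 0"
  obtains z where "poly p z = 0" "cmod (w - z) ^ degree p \<le> cmod (poly p w)"
proof -
  obtain root where ev: "\<And>u. poly p u = (\<Prod>i<degree p. u - root i)"
    using monic_poly_eq_prod[OF assms(1)] by blast
  have "{..<degree p} \<noteq> {}" using assms by auto
  then obtain j where j: "j < degree p" "\<And>i. i < degree p \<Longrightarrow> cmod (w - root j) \<le> cmod (w - root i)"
    using ex_min_if_finite[of "(\<lambda>i. cmod (w - root i)) ` {..<degree p}"] by (force simp: not_less)
  have "cmod (w - root j) ^ degree p = (\<Prod>i<degree p. cmod (w - root j))" by simp
  also have "\<dots> \<le> (\<Prod>i<degree p. cmod (w - root i))"
    using j by (intro prod_mono) auto
  also have "\<dots> = cmod (poly p w)" by (simp add: ev prod_norm)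
  finally have "cmod (w - root j) ^ degree p \<le> cmod (poly p w)" .
  moreover have "poly p (root j) = 0" using j(1) by (auto simp: ev)
  ultimately show thesis using that by blast
qed

text \<open>After division by \<open>\<sigma> y ^ degree f\<close> the norm becomes the value of
  \<open>map_poly \<sigma> f\<close> at the quotient of \<open>\<sigma> x\<close> by
  \<open>\<sigma> y\<close>, and the root nearest to this quotient gives the factor.\<close>

lemma embedding_norm_small_factor:
  assumes L: "subfield L complex_ring" and f: "is_min_poly L \<alpha> f" and xy: "x \<in> L" "y \<in> L"
    and \<sigma>: "\<sigma> \<in> embeddings L"
  obtains z where "poly (map_poly \<sigma> f) z = 0"
    "cmod (\<sigma> x - z * \<sigma> y) ^ degree f \<le> cmod (\<sigma> (rel_norm L (adjoin L \<alpha>) (x - \<alpha> * y)))"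
proof -
  define g where "g = map_poly \<sigma> f"
  have f': "f \<in> polys_over L" "lead_coeff f = 1" using f by (auto simp: is_min_poly_def polys_over_def)
  have g: "degree g = degree f" "lead_coeff g = 1" "degree g > 0"
    using f' min_poly_degree_pos[OF L f]
    by (simp_all add: g_def degree_map_embedding[OF L \<sigma>] coeff_map_embedding[OF L \<sigma>] embedding_1[OF L \<sigma>])
  \<comment> \<open>For \<open>y = 0\<close> this is 0 by the convention on division. The root
    chosen is then irrelevant, because both sides of the estimate equal
    \<open>cmod (\<sigma> x) ^ degree f\<close>.\<close>
  define w where "w = \<sigma> x / \<sigma> y"
  obtain z where z: "poly g z = 0" "cmod (w - z) ^ degree g \<le> cmod (poly g w)"
    using monic_poly_nearest_root[OF g(2,3)] .
  have "cmod (\<sigma> x - z * \<sigma> y) ^ degree f \<le> cmod (\<sigma> (rel_norm L (adjoin L \<alpha>) (x - \<alpha> * y)))"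
  proof (cases "y = 0")
    case True
    then show ?thesis
      using xy rel_norm_linear[OF L f xy] by (simp add: embedding_power[OF L \<sigma>] embedding_0[OF L \<sigma>] norm_power)
  next
    case False
    have \<sigma>y: "\<sigma> y \<noteq> 0" using False xy embedding_eq_0_iff[OF L \<sigma>] by simp
    have q: "x / y \<in> L" using xy by (rule subfield_closed(8)[OF L])
    have "\<sigma> (rel_norm L (adjoin L \<alpha>) (x - \<alpha> * y)) = \<sigma> y ^ degree f * poly g w"
      using False xy q f'(1)
      by (simp add: rel_norm_linear[OF L f xy] embedding_mult[OF L \<sigma>] subfield_power[OF L] poly_mem[OF L]
          embedding_power[OF L \<sigma>] g_def w_def embedding_divide[OF L \<sigma>, symmetric] poly_map_embedding[OF L \<sigma>])
    moreover have "\<sigma> x - z * \<sigma> y = \<sigma> y * (w - z)"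
      using \<sigma>y by (simp add: w_def field_simps)
    ultimately show ?thesis
      using z(2) by (simp add: norm_mult norm_power power_mult_distrib mult_left_mono g(1))
  qed
  with z(1) that show thesis by (simp add: g_def)
qed

subsection \<open>Minimal polynomials of algebraic integers and the house\<close>

lemma Rats_poly_clear_denominators:
  assumes "p \<in> polys_over \<rat>"
  obtains d :: int and P :: "int poly" where "d \<noteq> 0" "smult (of_int d) p = map_poly of_int P"
proof -
  have "\<exists>d P. (d::int) \<noteq> 0 \<and> smult (of_int d) p = map_poly of_int P"
    using assms
  proof (induction p)
    case 0
    show ?case by (intro exI[of _ 1] exI[of _ 0]) simp
  next
    case (pCons a p)
    have "a \<in> \<rat>" "p \<in> polys_over \<rat>"
      using pCons.prems polys_over_coeff[of "pCons a p" \<rat> 0] polys_over_coeff[of "pCons a p" \<rat> "Suc i" for i]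
      by (auto simp: polys_over_def)
    then obtain d P m n where dP: "(d::int) \<noteq> 0" "smult (of_int d) p = map_poly of_int P"
      and a: "(n::int) > 0" "a = of_int m / of_int n"
      using pCons.IH by (auto elim!: Rats_cases')
    have "smult (of_int (n * d)) p = smult (of_int n) (smult (of_int d) p)" by simp
    then have "smult (of_int (n * d)) (pCons a p) = map_poly of_int (pCons (m * d) (smult n P))"
      using a by (simp add: map_poly_pCons map_poly_smult dP(2))
    with dP a show ?case
      by (intro exI[of _ "n * d"] exI[of _ "pCons (m * d) (smult n P)"]) auto
  qed
  then show thesis using that by blast
qed

lemma map_poly_of_int_mult:
  "map_poly of_int (P * Q) = (map_poly of_int P * map_poly of_int Q :: complex poly)"
  by (simp add: poly_eq_iff coeff_map_poly coeff_mult)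

lemma content_monic: "lead_coeff P = (1::int) \<Longrightarrow> content P = 1"
  by (metis content_dvd_coeff is_unit_content_iff)

text \<open>Gauss's lemma: after clearing denominators in \<open>P = p * q\<close>, the contents of the two factors
  divide their leading coefficients, and multiply to the product of these.\<close>

lemma min_poly_algebraic_int:
  assumes "is_min_poly \<rat> x p" "algebraic_int x"
  shows "coeff p i \<in> \<int>"
proof -
  obtain P :: "int poly" where P: "poly (map_poly of_int P) x = 0" "lead_coeff P = 1"
    using assms(2) unfolding algebraic_int_altdef_ipoly by blast
  have "map_poly of_int P \<in> polys_over \<rat>" by (simp add: polys_over_def coeff_map_poly)
  then obtain q where q: "q \<in> polys_over \<rat>" "map_poly of_int P = p * q"
    using min_poly_dvd[OF subfield_Rats assms(1)] P(1) by metis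
  have p: "p \<in> polys_over \<rat>" "lead_coeff p = 1"
    using assms(1) by (auto simp: is_min_poly_def polys_over_def)
  have "lead_coeff (map_poly of_int P :: complex poly) = 1"
    using P(2) by (subst lead_coeff_map_poly_nz) auto
  then have "lead_coeff q = 1" using p(2) q(2) by (simp add: lead_coeff_mult)
  obtain d P1 where d: "d \<noteq> 0" "smult (of_int d) p = map_poly of_int P1"
    using Rats_poly_clear_denominators[OF p(1)] .
  obtain e Q1 where e: "e \<noteq> 0" "smult (of_int e) q = map_poly of_int Q1"
    using Rats_poly_clear_denominators[OF q(1)] .
  \<comment> \<open>Both \<open>p\<close> and \<open>q\<close> are monic, so scaling makes the
    denominators the leading coefficients.\<close>
  have lead: "lead_coeff P1 = d" "lead_coeff Q1 = e"
  proof -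
    have deg: "degree (map_poly of_int R :: complex poly) = degree R" for R :: "int poly"
      by (rule degree_map_poly) auto
    have "of_int (lead_coeff P1) = lead_coeff (map_poly of_int P1 :: complex poly)"
      "of_int (lead_coeff Q1) = lead_coeff (map_poly of_int Q1 :: complex poly)"
      by (simp_all add: deg coeff_map_poly)
    then have "of_int (lead_coeff P1) = (of_int d :: complex)" "of_int (lead_coeff Q1) = (of_int e :: complex)"
      using p(2) \<open>lead_coeff q = 1\<close> by (simp_all flip: d(2) e(2))
    then show "lead_coeff P1 = d" "lead_coeff Q1 = e" by simp_all
  qed
  have "map_poly of_int (smult (d * e) P) = (map_poly of_int (P1 * Q1) :: complex poly)"
    unfolding map_poly_of_int_mult d(2)[symmetric] e(2)[symmetric]
    by (simp add: map_poly_smult q(2) mult.commute)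
  then have "smult (d * e) P = P1 * Q1"
    by (simp add: poly_eq_iff coeff_map_poly) (metis of_int_eq_iff of_int_mult)
  \<comment> \<open>The monic polynomial \<open>P\<close> has content 1, and content is
    multiplicative.\<close>
  then have "content P1 * content Q1 = \<bar>d * e\<bar>"
    using content_monic[OF P(2)] by (metis content_mult content_smult mult.right_neutral normalize_int_def)
  moreover obtain a b where "d = content P1 * a" "e = content Q1 * b"
    using content_dvd_coeff[of P1 "degree P1"] content_dvd_coeff[of Q1 "degree Q1"] lead
    by (auto simp: dvd_def)
  ultimately have "content P1 * content Q1 * 1 = content P1 * content Q1 * \<bar>a * b\<bar>"
    using normalize_content[of P1] normalize_content[of Q1]
    by (simp add: abs_mult mult_ac del: normalize_content)
  then have "\<bar>a * b\<bar> = 1"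
    using \<open>d = _\<close> \<open>e = _\<close> d(1) e(1) by simp
  then have "\<bar>a\<bar> = 1" by (metis abs_mult zmult_eq_1_iff abs_ge_zero abs_zmult_eq_1)
  \<comment> \<open>Since \<open>a\<close> is a unit, \<open>d\<close> is the content of
    \<open>P1\<close> up to sign. Dividing \<open>P1\<close> by \<open>d\<close> to recover
    \<open>p\<close> thus keeps the coefficients integral.\<close>
  then have "d dvd content P1" using \<open>d = _\<close> by (metis abs_dvd_iff abs_mult dvd_abs_iff dvd_refl mult.right_neutral)
  then have "d dvd coeff P1 i" using content_dvd_coeff dvd_trans by blast
  then obtain c where "coeff P1 i = d * c" ..
  moreover have "of_int d * coeff p i = of_int (coeff P1 i)"
    using arg_cong[OF d(2), of "\<lambda>r. coeff r i"] by (simp add: coeff_map_poly)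
  ultimately have "coeff p i = of_int c" using d(1) by simp
  then show ?thesis by simp
qed

section \<open>Conjugates and the house of an algebraic integer\<close>

lemma algebraic_int_min_poly:
  assumes "algebraic_int x"
  obtains p where "is_min_poly \<rat> x p"
proof -
  obtain P :: "int poly" where P: "poly (map_poly of_int P) x = 0" "lead_coeff P = 1"
    using assms unfolding algebraic_int_altdef_ipoly by blast
  have "map_poly of_int P \<in> polys_over \<rat>" by (simp add: polys_over_def coeff_map_poly)
  moreover have "map_poly of_int P \<noteq> (0 :: complex poly)"
    using P(2) by (subst map_poly_eq_0_iff) auto
  ultimately show thesis
    using min_poly_exists[OF subfield_Rats] P(1) that by blast
qed

text \<open>Any two minimal polynomials divide each other, so the existential choice in
  \<open>conjugates\<close> makes no difference.\<close>

lemma conjugates_eq_roots: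
  assumes p: "is_min_poly \<rat> x p"
  shows "conjugates x = {z. poly p z = 0}"
proof -
  have "p dvd q" if q: "is_min_poly \<rat> x q" for q
  proof -
    have "q \<in> polys_over \<rat>" "poly q x = 0" using q by (auto simp: is_min_poly_def polys_over_def)
    then show ?thesis using min_poly_dvd[OF subfield_Rats p] by (metis dvd_triv_left)
  qed
  moreover have "q dvd p" if q: "is_min_poly \<rat> x q" for q
  proof -
    have "p \<in> polys_over \<rat>" "poly p x = 0" using p by (auto simp: is_min_poly_def polys_over_def)
    then show ?thesis using min_poly_dvd[OF subfield_Rats q] by (metis dvd_triv_left)
  qed
  ultimately show ?thesis
    using p unfolding conjugates_def dvd_def by fastforce
qed

lemma algebraic_int_conjugates:
  assumes "algebraic_int x"
  shows finite_conjugates: "finite (conjugates x)" and self_mem_conjugates: "x \<in> conjugates x"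
proof -
  obtain p where p: "is_min_poly \<rat> x p" using algebraic_int_min_poly[OF assms] .
  then have "p \<noteq> 0" "poly p x = 0" by (auto simp: is_min_poly_def)
  then show "finite (conjugates x)" "x \<in> conjugates x"
    by (simp_all add: conjugates_eq_roots[OF p] poly_roots_finite)
qed

lemma cmod_le_house: "algebraic_int x \<Longrightarrow> z \<in> conjugates x \<Longrightarrow> cmod z \<le> house x"
  unfolding house_def by (intro Max_ge finite_imageI finite_conjugates imageI)

lemma house_le:
  "algebraic_int x \<Longrightarrow> (\<And>z. z \<in> conjugates x \<Longrightarrow> cmod z \<le> B) \<Longrightarrow> house x \<le> B"
  unfolding house_def
  using finite_conjugates[of x] self_mem_conjugates[of x] by (subst Max_le_iff) auto

lemma house_nonneg: "algebraic_int x \<Longrightarrow> 0 \<le> house x"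
  by (rule order_trans[OF norm_ge_zero cmod_le_house[OF _ self_mem_conjugates]])

text \<open>Up to sign, the constant coefficient of the minimal polynomial is the product of its
  roots. It is a nonzero integer, and each root has modulus at most \<open>house x\<close>.\<close>

lemma house_ge_1:
  assumes "algebraic_int x" "x \<noteq> 0"
  shows "house x \<ge> 1"
proof -
  obtain p where p: "is_min_poly \<rat> x p" using algebraic_int_min_poly[OF assms(1)] .
  have deg: "degree p > 0" by (rule min_poly_degree_pos[OF subfield_Rats p])
  have p': "lead_coeff p = 1" "p \<in> polys_over \<rat>" "poly p x = 0"
    using p by (auto simp: is_min_poly_def polys_over_def)
  \<comment> \<open>With zero constant term, \<open>p\<close> is the variable times
    \<open>poly_shift 1 p\<close>. As \<open>x\<close> is nonzero, this quotient already vanishes at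
    \<open>x\<close>, against minimality.\<close>
  have "coeff p 0 \<noteq> 0"
  proof
    assume "coeff p 0 = 0"
    then have eq: "p = pCons 0 q" if "q = poly_shift 1 p" for q
      using that by (auto simp: poly_eq_iff coeff_pCons coeff_poly_shift split: nat.split)
    define q where "q = poly_shift 1 p"
    have "q \<in> polys_over \<rat>" using p'(2) by (simp add: q_def polys_over_def coeff_poly_shift)
    moreover have "poly q x = 0" using p'(3) eq[OF q_def] assms(2) by simp
    moreover have "q \<noteq> 0" using eq[OF q_def] p'(1) by auto
    ultimately have "degree p \<le> degree q" using p by (auto simp: is_min_poly_def polys_over_def)
    then show False using eq[OF q_def] \<open>q \<noteq> 0\<close> by simp
  qed
  moreover obtain c where c: "coeff p 0 = of_int c"
    using min_poly_algebraic_int[OF p assms(1), of 0] by (auto elim: Ints_cases)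
  ultimately have "1 \<le> \<bar>c\<bar>" by simp
  then have "1 \<le> cmod (coeff p 0)" using c by simp
  obtain root where ev: "\<And>u. poly p u = (\<Prod>i<degree p. u - root i)"
    using monic_poly_eq_prod[OF p'(1)] by blast
  have "cmod (coeff p 0) = (\<Prod>i<degree p. cmod (root i))"
    using ev[of 0] by (simp add: poly_0_coeff_0 flip: prod_norm)
  also have "\<dots> \<le> (\<Prod>i<degree p. house x)"
  proof (intro prod_mono conjI norm_ge_zero)
    fix i assume "i \<in> {..<degree p}"
    then have "root i \<in> conjugates x"
      by (auto simp: conjugates_eq_roots[OF p] ev)
    then show "cmod (root i) \<le> house x" by (rule cmod_le_house[OF assms(1)])
  qed
  finally have "1 \<le> house x ^ degree p" using \<open>1 \<le> cmod (coeff p 0)\<close> by simp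
  then show ?thesis
    using power_less_one_iff[OF house_nonneg[OF assms(1)], of "degree p"] deg by (simp add: not_less[symmetric])
qed

section \<open>Embeddings and conjugates\<close>

lemma embedding_conjugate:
  assumes M: "subfield M complex_ring" and \<sigma>: "\<sigma> \<in> embeddings M" and x: "x \<in> M" "algebraic_int x"
  shows "\<sigma> x \<in> conjugates x"
proof -
  obtain p where p: "is_min_poly \<rat> x p" using algebraic_int_min_poly[OF x(2)] .
  then have p': "\<And>i. coeff p i \<in> \<rat>" "poly p x = 0" by (auto simp: is_min_poly_def)
  then have "p \<in> polys_over M" using Rats_subset_subfield[OF M] by (auto simp: polys_over_def)
  moreover have "map_poly \<sigma> p = p"
    by (intro map_embedding_fixed[OF M \<sigma>] embedding_Rats[OF M \<sigma>] p'(1))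
  ultimately have "poly p (\<sigma> x) = 0"
    using poly_map_embedding[OF M \<sigma>, of p x] x(1) p'(2) embedding_0[OF M \<sigma>] by simp
  then show ?thesis by (simp add: conjugates_eq_roots[OF p])
qed

text \<open>Over \<open>M\<close>, \<open>f\<close> divides the rational minimal polynomial of
  \<xi>. Every \<sigma> fixes the latter, so \<open>map_poly \<sigma> f\<close> divides it as
  well.\<close>

lemma conjugate_roots_subset:
  assumes M: "subfield M complex_ring" and f: "is_min_poly M \<xi> f" and \<xi>: "algebraic_int \<xi>"
  shows "conjugate_roots M f \<subseteq> conjugates \<xi>"
proof -
  obtain p where p: "is_min_poly \<rat> \<xi> p" using algebraic_int_min_poly[OF \<xi>] .
  then have p': "\<And>i. coeff p i \<in> \<rat>" "poly p \<xi> = 0" by (auto simp: is_min_poly_def)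
  then have pM: "p \<in> polys_over M" using Rats_subset_subfield[OF M] by (auto simp: polys_over_def)
  have "poly p z = 0" if \<sigma>: "\<sigma> \<in> embeddings M" and z: "poly (map_poly \<sigma> f) z = 0" for \<sigma> z
  proof -
    have "map_poly \<sigma> p = p"
      by (intro map_embedding_fixed[OF M \<sigma>] embedding_Rats[OF M \<sigma>] p'(1))
    then have "map_poly \<sigma> f dvd p"
      using map_embedding_min_poly_dvd[OF M \<sigma> f pM p'(2)] by simp
    with z show ?thesis by (auto simp: dvd_def)
  qed
  then show ?thesis by (auto simp: conjugate_roots_def conjugates_eq_roots[OF p])
qed

text \<open>The identity embedding contributes \<xi> itself. Hence the minimum defining
  \<open>c\<^sub>0\<close> is over a nonempty set, and the non-reality assumption applies to
  \<xi>.\<close>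

lemma self_mem_conjugate_roots:
  assumes "subfield M complex_ring" "is_min_poly M \<xi> f"
  shows "\<xi> \<in> conjugate_roots M f"
proof -
  have "f \<in> polys_over M" "poly f \<xi> = 0"
    using assms(2) by (auto simp: is_min_poly_def polys_over_def)
  then show ?thesis
    using embeddings_id[OF assms(1)] map_poly_embeddings_id[OF assms(1)]
    unfolding conjugate_roots_def by force
qed

section \<open>The size bound for solutions of the relative Thue equation\<close>

theorem theorem1:
  fixes M K :: "complex set" and m k :: nat and \<xi> \<nu> :: complex
    and f :: "complex poly" and c\<^sub>0 :: real and F :: "complex \<Rightarrow> complex \<Rightarrow> complex"
  assumes "subfield M complex_ring" and "ring.dimension complex_ring m \<rat> M"
    and "totally_real M"
    and "K = generate_field complex_ring (insert \<xi> M)"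
    and "ring.dimension complex_ring k M K"
    and "algebraic_int \<xi>"
    and "is_min_poly M \<xi> f" and "\<forall>i. coeff f i \<in> integers_of M"
    and "\<forall>z\<in>conjugate_roots M f. z \<notin> \<real>"
    and "c\<^sub>0 = 1 / Min ((\<lambda>z. \<bar>Im z\<bar>) ` conjugate_roots M f)"
    and "\<nu> \<in> integers_of M" and "\<nu> \<noteq> 0"
    and "\<And>x y. F x y = rel_norm M K (x - \<xi> * y)"
  shows "\<forall>x\<in>integers_of M. \<forall>y\<in>integers_of M. F x y = \<nu> \<longrightarrow>
           max (house x) (house y) \<le> root k (house \<nu>) * (1 + c\<^sub>0 * house \<xi>)"
proof (intro ballI impI)
  fix x y
  assume xy: "x \<in> integers_of M" "y \<in> integers_of M" and F: "F x y = \<nu>"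
  note M = assms(1) and f = assms(7)
  have x: "x \<in> M" "algebraic_int x" and y: "y \<in> M" "algebraic_int y"
    and \<nu>: "\<nu> \<in> M" "algebraic_int \<nu>"
    using xy assms(11) by (auto simp: integers_of_def)
  have K: "K = adjoin M \<xi>"
    using assms(4) generate_field_eq_adjoin[OF M f] by simp
  \<comment> \<open>Both numbers are the dimension of \<open>K\<close> over \<open>M\<close>, which
    is unique.\<close>
  have k: "degree f = k"
    using complex_ring.dimension_is_inj[OF M dimension_adjoin[OF M f]] assms(5) K by simp
  have "k > 0" using min_poly_degree_pos[OF M f] k by simp
  have \<nu>_eq: "rel_norm M (adjoin M \<xi>) (x - \<xi> * y) = \<nu>"
    using F assms(13) K by simp
  define B where "B = root k (house \<nu>)"
  define \<delta> where "\<delta> = Min ((\<lambda>z. \<bar>Im z\<bar>) ` conjugate_roots M f)"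
  define H where "H = house \<xi>"
  have B0: "B \<ge> 0" unfolding B_def by (intro real_root_ge_zero house_nonneg \<nu>)
  \<comment> \<open>Finiteness comes from the conjugates of \<xi>, without counting the embeddings
    of \<open>M\<close>.\<close>
  have fin: "finite (conjugate_roots M f)"
    using conjugate_roots_subset[OF M f assms(6)] finite_conjugates[OF assms(6)] by (rule finite_subset)
  have \<xi>_root: "\<xi> \<in> conjugate_roots M f" by (rule self_mem_conjugate_roots[OF M f])
  have Im_ge: "\<delta> \<le> \<bar>Im z\<bar>" if "z \<in> conjugate_roots M f" for z
    unfolding \<delta>_def using fin that by (intro Min_le) auto
  have \<delta>: "\<delta> > 0"
    unfolding \<delta>_def using fin \<xi>_root assms(9)
    by (subst Min_gr_iff) (auto simp: complex_is_Real_iff)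
  have c0: "c\<^sub>0 = 1 / \<delta>" "c\<^sub>0 > 0" using assms(10) \<delta> by (simp_all add: \<delta>_def)
  \<comment> \<open>Zero is real, whereas \<xi> is one of the non-real conjugate roots.\<close>
  have "\<xi> \<noteq> 0" using assms(9) \<xi>_root by auto
  then have H: "H \<ge> 1" unfolding H_def by (rule house_ge_1[OF assms(6)])
  have bounds: "cmod (\<sigma> x) \<le> B * (1 + c\<^sub>0 * H) \<and> cmod (\<sigma> y) \<le> B * (1 + c\<^sub>0 * H)"
    if \<sigma>: "\<sigma> \<in> embeddings M" for \<sigma>
  proof -
    obtain z where z: "poly (map_poly \<sigma> f) z = 0" "cmod (\<sigma> x - z * \<sigma> y) ^ k \<le> cmod (\<sigma> \<nu>)"
      using embedding_norm_small_factor[OF M f x(1) y(1) \<sigma>] unfolding \<nu>_eq k .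
    have z_root: "z \<in> conjugate_roots M f" using z(1) \<sigma> by (auto simp: conjugate_roots_def)
    have "cmod z \<le> H"
      unfolding H_def using conjugate_roots_subset[OF M f assms(6)] z_root
      by (intro cmod_le_house[OF assms(6)]) auto
    have "cmod (\<sigma> x - z * \<sigma> y) ^ k \<le> house \<nu>"
      using z(2) cmod_le_house[OF \<nu>(2) embedding_conjugate[OF M \<sigma> \<nu>]] by simp
    then have "root k (cmod (\<sigma> x - z * \<sigma> y) ^ k) \<le> B"
      unfolding B_def using \<open>k > 0\<close> by simp
    then have small: "cmod (\<sigma> x - z * \<sigma> y) \<le> B"
      using \<open>k > 0\<close> by (simp add: real_root_power_cancel)
    have real: "\<sigma> x \<in> \<real>" "\<sigma> y \<in> \<real>"
      using assms(3) \<sigma> x(1) y(1) by (auto simp: totally_real_def)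
    have "\<delta> * cmod (\<sigma> y) \<le> \<bar>Im z\<bar> * cmod (\<sigma> y)"
      using Im_ge[OF z_root] by (simp add: mult_right_mono)
    also have "\<dots> = \<bar>Im (\<sigma> x - z * \<sigma> y)\<bar>"
      using real by (auto elim!: Reals_cases simp: abs_mult)
    also have "\<dots> \<le> B" using small abs_Im_le_cmod order_trans by blast
    finally have \<sigma>y: "cmod (\<sigma> y) \<le> c\<^sub>0 * B"
      using \<delta> by (simp add: c0(1) field_simps)
    have "c\<^sub>0 * B \<le> B * (1 + c\<^sub>0 * H)"
    proof -
      have "c\<^sub>0 * B * 1 \<le> c\<^sub>0 * B * H" using H c0(2) B0 by (intro mult_left_mono) auto
      then show ?thesis using B0 by (simp add: algebra_simps)
    qed
    moreover have "cmod (\<sigma> x) \<le> B * (1 + c\<^sub>0 * H)"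
    proof -
      have "cmod (\<sigma> x) \<le> cmod (\<sigma> x - z * \<sigma> y) + cmod (z * \<sigma> y)"
        using norm_triangle_ineq[of "\<sigma> x - z * \<sigma> y" "z * \<sigma> y"] by simp
      also have "\<dots> \<le> B + H * (c\<^sub>0 * B)"
        using small \<sigma>y \<open>cmod z \<le> H\<close> unfolding norm_mult
        by (intro add_mono mult_mono) (auto intro: order_trans[OF norm_ge_zero])
      finally show ?thesis by (simp add: algebra_simps)
    qed
    ultimately show ?thesis using \<sigma>y by linarith
  qed
  have "house w \<le> B * (1 + c\<^sub>0 * H)"
    if "w \<in> M" "algebraic_int w" "\<And>\<sigma>. \<sigma> \<in> embeddings M \<Longrightarrow> cmod (\<sigma> w) \<le> B * (1 + c\<^sub>0 * H)" for w
    using that(2)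
  proof (rule house_le)
    fix z assume "z \<in> conjugates w"
    then obtain \<sigma> where "\<sigma> \<in> embeddings M" "\<sigma> w = z"
      by (rule conjugate_eq_embedding[OF M assms(2) \<open>w \<in> M\<close>])
    with that(3) show "cmod z \<le> B * (1 + c\<^sub>0 * H)" by blast
  qed
  then show "max (house x) (house y) \<le> root k (house \<nu>) * (1 + c\<^sub>0 * house \<xi>)"
    using x y bounds by (simp add: B_def H_def)
qed

end
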